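(* Let $p\ge3$, $X\sim N_p(\theta,D)$ with $D=\operatorname{diag}(d_1,\ldots,d_p)$, $d_j>0$, and $\Gamma=\operatorname{diag}(\gamma_1,\ldots,\gamma_p)$, $\gamma_j\ge0$. Let $d_j^*=d_j^2/(d_j+\gamma_j)$ with indices sorted so that $d_1^*\ge\cdots\ge d_p^*$. Let $A^\dagger=\operatorname{diag}(a_1^\dagger,\ldots,a_p^\dagger)$ be the unique maximizer of $c^*(D,A)=\sum_j d_ja_j-2\max_j d_ja_j$ over $a_j\ge0$ with $\sum_j(d_j+\gamma_j)a_j^2=\sum_j d_j^*$, let $\nu$ be the largest index with $d_\nu a_\nu^\dagger=\max_j d_ja_j^\dagger$, and let $\delta_{A^\dagger(\Gamma)}(X)=X-\frac{c^*(D,A^\dagger)}{X^\top A^{\dagger\top}A^\dagger X}A^\dagger X$. Let $\mathcal H_\Gamma=\{\theta:\theta_j^2\le\gamma_j,\ j=1,\ldots,p\}$ and $R(\delta,\mathcal H_\Gamma)=\sup_{\theta\in\mathcal H_\Gamma}E_\theta\|\delta(X)-\theta\|^2$. If $\nu=3$, then \[ R\{\delta_{A^\dagger(\Gamma)},\mathcal H_\Gamma\}\le\operatorname{tr}(D)-\sum_{j=3}^pd_j^*+\frac23d_3^*. \] If $\nu\ge4$, then \[ R\{\delta_{A^\dagger(\Gamma)},\mathcal H_\Gamma\}\le\operatorname{tr}(D)-\sum_{j=3}^pd_j^*+\Big(d_3^*+d_4^*-4\frac{d_\nu^*}{\nu}\Big)\le\operatorname{tr}(D)-\sum_{j=3}^pd_j^*+(d_3^*+d_4^*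 ). \]
   Context: The maximizer $A^\dagger$ exists and is unique. *)

theory Defs
  imports "HOL-Probability.Probability"
begin

text \<open>Vectors in R^p are functions nat => real, indices 1..p. Diagonal matrices are given
  by their diagonal entries.\<close>

definition dstar :: "(nat \<Rightarrow> real) \<Rightarrow> (nat \<Rightarrow> real) \<Rightarrow> nat \<Rightarrow> real" where
  "dstar d \<gamma> j = (d j)^2 / (d j + \<gamma> j)"

definition cstar :: "nat \<Rightarrow> (nat \<Rightarrow> real) \<Rightarrow> (nat \<Rightarrow> real) \<Rightarrow> real" where
  "cstar p d a = (\<Sum>j\<in>{1..p}. d j * a j) - 2 * Max ((\<lambda>j. d j * a j) ` {1..p})"

definition feasible :: "nat \<Rightarrow> (nat \<Rightarrow> real) \<Rightarrow> (nat \<Rightarrow> real) \<Rightarrow> (nat \<Rightarrow> real) \<Rightarrow> bool" where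
  "feasible p d \<gamma> a \<longleftrightarrow> (\<forall>j\<in>{1..p}. a j \<ge> 0) \<and>
     (\<Sum>j\<in>{1..p}. (d j + \<gamma> j) * (a j)^2) = (\<Sum>j\<in>{1..p}. dstar d \<gamma> j)"

definition is_maximizer :: "nat \<Rightarrow> (nat \<Rightarrow> real) \<Rightarrow> (nat \<Rightarrow> real) \<Rightarrow> (nat \<Rightarrow> real) \<Rightarrow> bool" where
  "is_maximizer p d \<gamma> a \<longleftrightarrow> feasible p d \<gamma> a \<and>
     (\<forall>b. feasible p d \<gamma> b \<longrightarrow> cstar p d b \<le> cstar p d a)"

definition nu_idx :: "nat \<Rightarrow> (nat \<Rightarrow> real) \<Rightarrow> (nat \<Rightarrow> real) \<Rightarrow> nat" where
  "nu_idx p d a = (GREATEST j. j \<in> {1..p} \<and> d j * a j = Max ((\<lambda>k. d k * a k) ` {1..p}))"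

definition delta_est :: "nat \<Rightarrow> (nat \<Rightarrow> real) \<Rightarrow> (nat \<Rightarrow> real) \<Rightarrow> (nat \<Rightarrow> real) \<Rightarrow> (nat \<Rightarrow> real)" where
  "delta_est p d a x = (\<lambda>j. x j - cstar p d a / (\<Sum>k\<in>{1..p}. (a k * x k)^2) * (a j * x j))"

definition normal_diag :: "nat \<Rightarrow> (nat \<Rightarrow> real) \<Rightarrow> (nat \<Rightarrow> real) \<Rightarrow> (nat \<Rightarrow> real) measure" where
  "normal_diag p \<theta> d = PiM {1..p} (\<lambda>j. density lborel (normal_density (\<theta> j) (sqrt (d j))))"

definition risk :: "nat \<Rightarrow> ((nat \<Rightarrow> real) \<Rightarrow> (nat \<Rightarrow> real)) \<Rightarrow> (nat \<Rightarrow> real) \<Rightarrow> (nat \<Rightarrow> real) \<Rightarrow> ennreal" where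
  "risk p \<delta> \<theta> d = (\<integral>\<^sup>+ x. ennreal (\<Sum>j\<in>{1..p}. (\<delta> x j - \<theta> j)^2) \<partial>normal_diag p \<theta> d)"

definition H_set :: "nat \<Rightarrow> (nat \<Rightarrow> real) \<Rightarrow> (nat \<Rightarrow> real) set" where
  "H_set p \<gamma> = {\<theta>. \<forall>j\<in>{1..p}. (\<theta> j)^2 \<le> \<gamma> j}"

definition max_risk :: "nat \<Rightarrow> ((nat \<Rightarrow> real) \<Rightarrow> (nat \<Rightarrow> real)) \<Rightarrow> (nat \<Rightarrow> real) \<Rightarrow> (nat \<Rightarrow> real) \<Rightarrow> ennreal" where
  "max_risk p \<delta> d \<gamma> = (SUP \<theta>\<in>H_set p \<gamma>. risk p \<delta> \<theta> d)"

end

theory Submission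
  imports Defs
begin

text \<open>
  Write \<open>s j\<close> for \<open>d\<^sup>*\<close> and \<open>u j = d j * a j\<close>. The constraint becomes
  \<open>\<Sum> u\<^sup>2 / s = \<Sum> s\<close>, and with the level \<open>m\<close> solving \<open>\<Sum> (1 - min s m / s) = 2\<close> one has
  \<open>\<Sum> u - 2 max u \<le> \<Sum> u (min s m) / s\<close>. By Cauchy--Schwarz the maximizer is the multiple
  of \<open>min s m\<close> that satisfies the constraint, \<open>\<nu>\<close> is the last index with \<open>s j \<ge> m\<close>, and
  \<open>c\<^sup>2 / \<Sum> s = m (\<nu> - 2) + \<Sum>\<^bsub>j > \<nu>\<^esub> s j\<close>.

  The risk is at most \<open>tr D - c\<^sup>2 / E Q\<close>, where \<open>Q\<close> is the squared norm of \<open>A X\<close>, by Stein's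
  identity and Jensen's inequality. Stein's identity is applied with \<open>Q\<close> replaced by \<open>Q + \<epsilon>\<close>,
  which makes the shrinkage field bounded with bounded derivatives; Fatou's lemma removes
  \<open>\<epsilon>\<close>, so the integrability of \<open>1 / Q\<close> is never needed.
\<close>

section \<open>Gaussian integration by parts in one variable\<close>

lemma integrable_mult_bounded:
  fixes f g :: "'a \<Rightarrow> real"
  assumes "integrable M f" "g \<in> borel_measurable M" "\<And>x. \<bar>g x\<bar> \<le> B"
  shows "integrable M (\<lambda>x. f x * g x)"
proof (rule Bochner_Integration.integrable_bound)
  show "integrable M (\<lambda>x. B * f x)"
    using assms(1) by simp
  show "(\<lambda>x. f x * g x) \<in> borel_measurable M"
    using assms(1,2) by measurable
  have "\<bar>f x * g x\<bar> \<le> \<bar>B * f x\<bar>" for x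
  proof -
    have "\<bar>g x\<bar> * \<bar>f x\<bar> \<le> B * \<bar>f x\<bar>" "0 \<le> B"
      using assms(3)[of x] by (auto intro: mult_right_mono)
    then show ?thesis
      by (simp add: abs_mult mult.commute)
  qed
  then show "AE x in M. norm (f x * g x) \<le> norm (B * f x)"
    by simp
qed

lemma normal_density_tendsto_0:
  assumes "\<sigma> > 0"
  shows "(normal_density \<mu> \<sigma> \<longlongrightarrow> 0) at_infinity"
proof -
  have "filterlim (\<lambda>x. norm (x - \<mu>)) at_top at_infinity"
    by (rule filterlim_at_infinity_imp_norm_at_top)
       (use tendsto_add_filterlim_at_infinity[OF tendsto_const[of "-\<mu>"] filterlim_ident] in simp)
  then have "filterlim (\<lambda>x. (1 / (2 * \<sigma>\<^sup>2)) * (norm (x - \<mu>)) ^ 2) at_top at_infinity"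
    using assms by (intro filterlim_tendsto_pos_mult_at_top[OF tendsto_const]
        filterlim_pow_at_top) auto
  then have "filterlim (\<lambda>x. - (x - \<mu>)\<^sup>2 / (2 * \<sigma>\<^sup>2)) at_bot at_infinity"
    by (simp add: filterlim_uminus_at_top)
  then have "((\<lambda>x. 1 / sqrt (2 * pi * \<sigma>\<^sup>2) * exp (- (x - \<mu>)\<^sup>2 / (2 * \<sigma>\<^sup>2))) \<longlongrightarrow> 0) at_infinity"
    by (intro tendsto_mult_right_zero filterlim_compose[OF exp_at_bot])
  then show ?thesis
    by (simp add: normal_density_def[abs_def])
qed

lemma normal_density_has_real_derivative:
  assumes "\<sigma> > 0"
  shows "(normal_density \<mu> \<sigma> has_real_derivative - (x - \<mu>) / \<sigma>\<^sup>2 * normal_density \<mu> \<sigma> x) (at x)"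
  unfolding normal_density_def
  by (rule derivative_eq_intros refl | use assms in \<open>simp add: field_simps power2_eq_square\<close>)+

text \<open>Since the normal density satisfies
  \<open>\<phi>' = - (x - \<mu>) / \<sigma>\<^sup>2 * \<phi>\<close>, the integrand times
  \<open>\<phi>\<close> is the derivative of \<open>- \<sigma>\<^sup>2 * h * \<phi>\<close>. The
  fundamental theorem of calculus on the whole line leaves only boundary terms, and these vanish
  because \<open>h\<close> is bounded.\<close>

lemma stein_identity_normal:
  fixes h h' :: "real \<Rightarrow> real"
  assumes \<sigma>: "\<sigma> > 0"
    and deriv: "\<And>x. (h has_real_derivative h' x) (at x)"
    and cont: "continuous_on UNIV h'"
    and h: "\<And>x. \<bar>h x\<bar> \<le> B" and h': "\<And>x. \<bar>h' x\<bar> \<le> B'"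
  shows "(\<integral>x. (x - \<mu>) * h x - \<sigma>\<^sup>2 * h' x \<partial>density lborel (normal_density \<mu> \<sigma>)) = 0"
proof -
  let ?\<phi> = "normal_density \<mu> \<sigma>"
  define F where "F x = - \<sigma>\<^sup>2 * (h x * ?\<phi> x)" for x
  define f where "f x = ?\<phi> x * ((x - \<mu>) * h x - \<sigma>\<^sup>2 * h' x)" for x
  have conth: "continuous_on UNIV h"
    using deriv by (meson DERIV_continuous_on DERIV_subset top_greatest)
  have [measurable]: "h \<in> borel_measurable borel" "h' \<in> borel_measurable borel"
    using conth cont by (auto intro: borel_measurable_continuous_onI)
  have F: "(F has_real_derivative f x) (at x)" for x
    unfolding F_def f_def
    by (rule derivative_eq_intros deriv normal_density_has_real_derivative[OF \<sigma>] refl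
        | use \<sigma> in \<open>simp add: field_simps\<close>)+
  have "isCont ?\<phi> x" for x
    using normal_density_has_real_derivative[OF \<sigma>] by (rule DERIV_isCont)
  then have contf: "isCont f x" for x
    unfolding f_def using conth cont
    by (auto intro!: continuous_intros simp: continuous_on_eq_continuous_at)
  have "integrable lborel (\<lambda>x. (?\<phi> x * (x - \<mu>)) * h x)"
    using integrable_normal_moment[OF \<sigma>, of \<mu> 1] h
    by - (rule integrable_mult_bounded[where B=B], auto)
  moreover have "integrable lborel (\<lambda>x. ?\<phi> x * h' x)"
    using integrable_normal_density[OF \<sigma>] h' by - (rule integrable_mult_bounded[where B=B'], auto)
  ultimately have "integrable lborel (\<lambda>x. (?\<phi> x * (x - \<mu>)) * h x - \<sigma>\<^sup>2 * (?\<phi> x * h' x))"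
    by simp
  then have int: "integrable lborel f"
    by (simp add: f_def[abs_def] algebra_simps)
  have "(F \<longlongrightarrow> 0) at_infinity"
  proof (rule Lim_null_comparison)
    show "\<forall>\<^sub>F x in at_infinity. norm (F x) \<le> \<sigma>\<^sup>2 * B * ?\<phi> x"
      using h by (intro always_eventually allI) 
        (auto simp: F_def abs_mult mult.assoc intro!: mult_left_mono mult_right_mono)
    show "((\<lambda>x. \<sigma>\<^sup>2 * B * ?\<phi> x) \<longlongrightarrow> 0) at_infinity"
      by (intro tendsto_mult_right_zero normal_density_tendsto_0[OF \<sigma>])
  qed
  then have top: "(F \<longlongrightarrow> 0) at_top" and bot: "(F \<longlongrightarrow> 0) at_bot"
    by (auto intro: tendsto_mono[OF at_top_le_at_infinity] tendsto_mono[OF at_bot_le_at_infinity])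
  have "(LBINT x=-\<infinity>..\<infinity>. f x) = 0 - 0"
  proof (rule interval_integral_FTC_integrable)
    show "((F \<circ> real_of_ereal) \<longlongrightarrow> 0) (at_right (- \<infinity>))"
      using bot unfolding ereal_tendsto_simps .
    show "((F \<circ> real_of_ereal) \<longlongrightarrow> 0) (at_left \<infinity>)"
      using top unfolding ereal_tendsto_simps .
  qed (use F contf int in \<open>auto simp: set_integrable_def has_real_derivative_iff_has_vector_derivative\<close>)
  then have "integral\<^sup>L lborel f = 0"
    by (simp add: interval_lebesgue_integral_def set_lebesgue_integral_def)
  then show ?thesis
    by (subst integral_density) (auto simp: f_def[abs_def])
qed

section \<open>Moments and Stein's identity for independent normal coordinates\<close>

text \<open>Positivity is asked at every index because \<open>product_prob_space\<close> wants each
  factor \<open>M j\<close> to be a probability measure, inside \<open>{1..p}\<close> or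
  not.\<close>

locale diag_normal =
  fixes p :: nat and \<theta> d :: "nat \<Rightarrow> real"
  assumes d_pos: "\<And>j. d j > 0"
begin

abbreviation M where "M j \<equiv> density lborel (normal_density (\<theta> j) (sqrt (d j)))"
abbreviation P where "P \<equiv> normal_diag p \<theta> d"

lemma prob_space_M: "prob_space (M j)"
  using d_pos by (intro prob_space_normal_density) auto

sublocale product_prob_space M "{1..p}"
  using prob_space_M by (simp add: product_prob_space_def product_prob_space_axioms_def
      product_sigma_finite_def prob_space_imp_sigma_finite)

lemma prob_space_P: "prob_space P"
  unfolding normal_diag_def using prob_space_M by (intro prob_space_PiM)

lemma measurable_coord [measurable]:
  assumes "j \<in> {1..p}"
  shows "(\<lambda>x. x j) \<in> borel_measurable P"
proof -
  have "(\<lambda>x. x j) \<in> measurable P (M j)"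
    unfolding normal_diag_def using assms by (rule measurable_component_singleton)
  then show ?thesis by simp
qed

text \<open>The marginal of the product in coordinate \<open>j\<close> is \<open>M j\<close>, so
  moments of one coordinate reduce to the one-dimensional normal moments.\<close>

lemma has_bochner_integral_coord:
  fixes f :: "real \<Rightarrow> real"
  assumes "j \<in> {1..p}" "has_bochner_integral lborel (\<lambda>t. normal_density (\<theta> j) (sqrt (d j)) t * f t) v"
    and [measurable]: "f \<in> borel_measurable borel"
  shows "has_bochner_integral P (\<lambda>x. f (x j)) v"
proof -
  have "has_bochner_integral (M j) f v"
    using assms by (subst has_bochner_integral_density) auto
  moreover have "M j = distr P (M j) (\<lambda>x. x j)"
    unfolding normal_diag_def using distr_PiM_component[OF prob_space_M assms(1)] by (rule sym)
  ultimately have "has_bochner_integral (distr P (M j) (\<lambda>x. x j)) f v"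
    by simp
  moreover have "(\<lambda>x. x j) \<in> measurable P (M j)"
    unfolding normal_diag_def using assms(1) by (rule measurable_component_singleton)
  ultimately show ?thesis
    using assms(3) by (auto simp: has_bochner_integral_iff integral_distr integrable_distr_eq)
qed

lemma has_bochner_integral_coord_centered:
  assumes "j \<in> {1..p}"
  shows "has_bochner_integral P (\<lambda>x. x j - \<theta> j) 0"
  using normal_moment_odd[of "sqrt (d j)" "\<theta> j" 0] d_pos[of j] by (intro has_bochner_integral_coord[OF assms]) auto

lemma has_bochner_integral_coord_variance:
  assumes "j \<in> {1..p}"
  shows "has_bochner_integral P (\<lambda>x. (x j - \<theta> j)\<^sup>2) (d j)"
  using normal_moment_even[of "sqrt (d j)" "\<theta> j" 1] d_pos[of j]
  by (intro has_bochner_integral_coord[OF assms]) (auto simp: fact_numeral)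

lemma has_bochner_integral_coord_square:
  assumes "j \<in> {1..p}"
  shows "has_bochner_integral P (\<lambda>x. (x j)\<^sup>2) (d j + (\<theta> j)\<^sup>2)"
proof -
  interpret prob_space P by (rule prob_space_P)
  have "has_bochner_integral P (\<lambda>x. (\<theta> j)\<^sup>2) ((\<theta> j)\<^sup>2)"
    by (simp add: has_bochner_integral_iff prob_space)
  then have "has_bochner_integral P
      (\<lambda>x. (x j - \<theta> j)\<^sup>2 + 2 * \<theta> j * (x j - \<theta> j) + (\<theta> j)\<^sup>2) (d j + 2 * \<theta> j * 0 + (\<theta> j)\<^sup>2)"
    by (intro has_bochner_integral_add has_bochner_integral_mult_right
        has_bochner_integral_coord_variance[OF assms] has_bochner_integral_coord_centered[OF assms])
  then show ?thesis
    by (simp add: power2_eq_square algebra_simps)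
qed

text \<open>By Fubini, coordinate \<open>j\<close> is integrated first with the others frozen; the
  inner integral is zero by the one-dimensional identity. Boundedness of \<open>g\<close> and
  \<open>g'\<close> supplies all the integrability.\<close>

lemma stein_identity:
  assumes j: "j \<in> {1..p}"
    and [measurable]: "g \<in> borel_measurable P" "g' \<in> borel_measurable P"
    and deriv: "\<And>x t. ((\<lambda>t. g (x(j := t))) has_real_derivative g' (x(j := t))) (at t)"
    and cont: "\<And>x. continuous_on UNIV (\<lambda>t. g' (x(j := t)))"
    and g: "\<And>x. \<bar>g x\<bar> \<le> B" and g': "\<And>x. \<bar>g' x\<bar> \<le> B'"
  shows "integrable P g'" "has_bochner_integral P (\<lambda>x. (x j - \<theta> j) * g x) (d j * integral\<^sup>L P g')"
proof -
  interpret N: prob_space P by (rule prob_space_P)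
  show g'_int: "integrable P g'"
    using g' by (intro N.integrable_const_bound[where B=B']) auto
  have g_int: "integrable P (\<lambda>x. (x j - \<theta> j) * g x)"
    using has_bochner_integral_coord_centered[OF j] g by - (rule integrable_mult_bounded[where B=B], auto simp: has_bochner_integral_iff)
  let ?f = "\<lambda>x. (x j - \<theta> j) * g x - d j * g' x"
  have f_int: "integrable P ?f"
    using g_int g'_int by simp
  \<comment> \<open>The index set is written as an insertion so that
    \<open>product_integral_insert\<close> can split off coordinate \<open>j\<close>.\<close>
  have ins: "insert j ({1..p} - {j}) = {1..p}"
    using j by auto
  have "integral\<^sup>L P ?f = integral\<^sup>L (PiM (insert j ({1..p} - {j})) M) ?f"
    unfolding ins normal_diag_def ..
  also have "\<dots> = (\<integral>x. (\<integral>t. ?f (x(j := t)) \<partial>M j) \<partial>PiM ({1..p} - {j}) M)"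
    using f_int unfolding normal_diag_def
    by (intro product_integral_insert) (simp_all only: ins, auto)
  also have "\<dots> = 0"
  proof -
    have "(\<integral>t. ?f (x(j := t)) \<partial>M j) = 0" for x
      using stein_identity_normal[where \<sigma>="sqrt (d j)" and \<mu>="\<theta> j" and h="\<lambda>t. g (x(j := t))" and h'="\<lambda>t. g' (x(j := t))"
          and B=B and B'=B'] d_pos[of j] deriv cont g g' by simp
    then show ?thesis by simp
  qed
  finally show "has_bochner_integral P (\<lambda>x. (x j - \<theta> j) * g x) (d j * integral\<^sup>L P g')"
    using g_int g'_int by (simp add: has_bochner_integral_iff)
qed

end

section \<open>Risk bound for the regularized estimator\<close>

text \<open>With \<open>y j = a j * x j\<close> and \<open>w j = d j * a j\<close>, the left side is
  what remains of the loss beyond \<open>tr D\<close> once Stein's identity has replaced the cross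
  term by a divergence. It is at most \<open>- c\<^sup>2 / (Q + \<epsilon>)\<close>. The right side
  replaces this by a bound affine in \<open>Q\<close>, whose expectation only involves second
  moments.\<close>

lemma stein_regularized_bound:
  fixes y w :: "'i \<Rightarrow> real"
  assumes Q: "Q = (\<Sum>j\<in>I. (y j)\<^sup>2)" and \<epsilon>: "\<epsilon> > 0" and \<mu>: "\<mu> > 0"
    and w: "\<And>j. j \<in> I \<Longrightarrow> w j \<le> m" "m \<ge> 0" and c: "c = (\<Sum>j\<in>I. w j) - 2 * m" "c \<ge> 0"
  shows "c\<^sup>2 * (Q / (Q + \<epsilon>)\<^sup>2) - 2 * c * (\<Sum>j\<in>I. w j * (1 / (Q + \<epsilon>) - 2 * (y j)\<^sup>2 / (Q + \<epsilon>)\<^sup>2))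
    \<le> - c\<^sup>2 * (2 / \<mu> - (Q + \<epsilon>) / \<mu>\<^sup>2)"
proof -
  define z where "z = Q + \<epsilon>"
  have Q0: "0 \<le> Q"
    unfolding Q by (intro sum_nonneg) auto
  have z: "z > 0" "Q \<le> z"
    using Q0 \<epsilon> by (auto simp: z_def)
  have zQ: "Q / z\<^sup>2 \<le> 1 / z"
    using z by (simp add: field_simps power2_eq_square)
  have "(\<Sum>j\<in>I. w j * (y j)\<^sup>2) \<le> (\<Sum>j\<in>I. m * (y j)\<^sup>2)"
    by (intro sum_mono mult_right_mono w) auto
  then have *: "(\<Sum>j\<in>I. w j * (y j)\<^sup>2) \<le> m * Q"
    by (simp add: Q sum_distrib_left)
  have "(\<Sum>j\<in>I. w j * (1 / z - 2 * (y j)\<^sup>2 / z\<^sup>2))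
      = (\<Sum>j\<in>I. w j) / z - 2 * (\<Sum>j\<in>I. w j * (y j)\<^sup>2) / z\<^sup>2"
    by (simp add: right_diff_distrib sum_subtractf sum_distrib_left sum_divide_distrib mult_ac)
  also have "\<dots> \<ge> (c + 2 * m) / z - 2 * (m * Q) / z\<^sup>2"
    using * z c by (intro diff_mono divide_right_mono) auto
  finally have 1: "(c + 2 * m) / z - 2 * (m * Q) / z\<^sup>2
      \<le> (\<Sum>j\<in>I. w j * (1 / z - 2 * (y j)\<^sup>2 / z\<^sup>2))" .
  \<comment> \<open>The \<open>2 * m\<close> subtracted in \<open>c\<close> is exactly what pays for
    the negative part of the divergence, because \<open>Q / z\<^sup>2 \<le> 1 / z\<close>.\<close>
  have "2 * (m * Q) / z\<^sup>2 = 2 * m * (Q / z\<^sup>2)"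
    by simp
  also have "\<dots> \<le> 2 * m * (1 / z)"
    using zQ w(2) by (intro mult_left_mono) auto
  finally have "c / z \<le> (c + 2 * m) / z - 2 * (m * Q) / z\<^sup>2"
    by (simp add: add_divide_distrib)
  with 1 have "c / z \<le> (\<Sum>j\<in>I. w j * (1 / z - 2 * (y j)\<^sup>2 / z\<^sup>2))"
    by linarith
  then have "2 * c * (c / z) \<le> 2 * c * (\<Sum>j\<in>I. w j * (1 / z - 2 * (y j)\<^sup>2 / z\<^sup>2))"
    using c by (intro mult_left_mono) auto
  moreover have "c\<^sup>2 * (Q / z\<^sup>2) \<le> c\<^sup>2 * (1 / z)"
    using zQ by (intro mult_left_mono) auto
  \<comment> \<open>the tangent to \<open>1 / z\<close> at \<open>\<mu>\<close>, a pointwise form of Jensen's inequality\<close>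
  moreover have "c\<^sup>2 * (2 / \<mu> - z / \<mu>\<^sup>2) \<le> c\<^sup>2 * (1 / z)"
  proof (intro mult_left_mono)
    have "0 \<le> (z - \<mu>)\<^sup>2 / (z * \<mu>\<^sup>2)"
      using z by simp
    also have "\<dots> = 1 / z - (2 / \<mu> - z / \<mu>\<^sup>2)"
      using z \<mu> by (simp add: field_simps power2_eq_square)
    finally show "2 / \<mu> - z / \<mu>\<^sup>2 \<le> 1 / z"
      by simp
  qed auto
  \<comment> \<open>One copy of \<open>c\<^sup>2 / z\<close> absorbs the squared term, the other is
    compared with the tangent.\<close>
  moreover have "2 * c * (c / z) = c\<^sup>2 * (1 / z) + c\<^sup>2 * (1 / z)"
    by (simp add: power2_eq_square)
  ultimately show ?thesis
    unfolding z_def by linarith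
qed

context diag_normal
begin

definition quad where "quad a x = (\<Sum>k\<in>{1..p}. (a k * x k)\<^sup>2)"

definition shrink where "shrink a \<epsilon> j x = a j * x j / (quad a x + \<epsilon>)"

text \<open>For \<open>\<epsilon> > 0\<close> this is the partial derivative of
  \<open>shrink a \<epsilon> j\<close> in the \<open>j\<close>-th coordinate.\<close>

definition shrink' where
  "shrink' a \<epsilon> j x = a j * (1 / (quad a x + \<epsilon>) - 2 * (a j * x j)\<^sup>2 / (quad a x + \<epsilon>)\<^sup>2)"

context
  fixes a :: "nat \<Rightarrow> real" and \<epsilon> :: real
  assumes \<epsilon>: "\<epsilon> > 0"
begin

lemma quad_nonneg: "0 \<le> quad a x"
  unfolding quad_def by (intro sum_nonneg) auto

lemma coord_le_quad: "j \<in> {1..p} \<Longrightarrow> (a j * x j)\<^sup>2 \<le> quad a x"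
  unfolding quad_def by (intro member_le_sum) auto

lemma quad_measurable [measurable]: "quad a \<in> borel_measurable P"
  unfolding quad_def[abs_def] by measurable

text \<open>From \<open>2 * \<bar>y\<bar> \<le> y\<^sup>2 + 1\<close> the numerator is at most
  \<open>quad a x + 1\<close>, which is comparable to \<open>quad a x + \<epsilon>\<close>. Only
  uniformity in \<open>x\<close> matters, so the constant is crude.\<close>

lemma shrink_bounded:
  assumes "j \<in> {1..p}"
  shows "\<bar>shrink a \<epsilon> j x\<bar> \<le> 1 + 1 / \<epsilon>"
proof -
  have "0 \<le> (\<bar>a j * x j\<bar> - 1)\<^sup>2"
    by simp
  then have "2 * \<bar>a j * x j\<bar> \<le> (a j * x j)\<^sup>2 + 1"
    by (simp add: power2_diff power_mult_distrib del: zero_le_power2)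
  moreover have "0 \<le> (a j * x j)\<^sup>2" by simp
  ultimately have "\<bar>a j * x j\<bar> \<le> quad a x + 1"
    using coord_le_quad[OF assms, of x] by linarith
  also have "\<dots> \<le> (1 + 1 / \<epsilon>) * (quad a x + \<epsilon>)"
    using \<epsilon> quad_nonneg[of x] by (simp add: field_simps)
  finally show ?thesis
    using \<epsilon> quad_nonneg[of x] by (simp add: shrink_def abs_mult pos_divide_le_eq)
qed

text \<open>As \<open>(a j * x j)\<^sup>2 \<le> quad a x\<close>, both terms of the derivative are
  controlled by the reciprocal of \<open>quad a x + \<epsilon>\<close>, hence by
  \<open>1 / \<epsilon>\<close>.\<close>

lemma shrink'_bounded:
  assumes "j \<in> {1..p}"
  shows "\<bar>shrink' a \<epsilon> j x\<bar> \<le> \<bar>a j\<bar> * (3 / \<epsilon>)"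
proof -
  have z: "quad a x + \<epsilon> > 0" "quad a x + \<epsilon> \<ge> \<epsilon>"
    using \<epsilon> quad_nonneg[of x] by auto
  have "(a j * x j)\<^sup>2 / (quad a x + \<epsilon>)\<^sup>2 \<le> (quad a x + \<epsilon>) / (quad a x + \<epsilon>)\<^sup>2"
    using coord_le_quad[OF assms, of x] \<epsilon> by (intro divide_right_mono) auto
  also have "\<dots> = 1 / (quad a x + \<epsilon>)"
    using z by (simp add: power2_eq_square)
  finally have "(a j * x j)\<^sup>2 / (quad a x + \<epsilon>)\<^sup>2 \<le> 1 / (quad a x + \<epsilon>)" .
  moreover have "1 / (quad a x + \<epsilon>) \<le> 1 / \<epsilon>" "0 \<le> 1 / (quad a x + \<epsilon>)" "0 \<le> (a j * x j)\<^sup>2 / (quad a x + \<epsilon>)\<^sup>2"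
    using z \<epsilon> by (auto intro: divide_left_mono)
  ultimately have "\<bar>1 / (quad a x + \<epsilon>) - 2 * (a j * x j)\<^sup>2 / (quad a x + \<epsilon>)\<^sup>2\<bar> \<le> 3 / \<epsilon>"
    unfolding abs_le_iff times_divide_eq_right[symmetric] by linarith
  then show ?thesis
    unfolding shrink'_def abs_mult by (intro mult_left_mono) auto
qed

text \<open>Along a line in direction \<open>j\<close> the denominator is a quadratic in
  \<open>t\<close> alone; the nonnegative remainder \<open>r\<close> keeps it positive after adding
  \<open>\<epsilon>\<close>.\<close>

lemma quad_upd:
  assumes "j \<in> {1..p}"
  obtains r where "r \<ge> 0" "\<And>t. quad a (x(j := t)) = (a j * t)\<^sup>2 + r"
proof
  show "0 \<le> (\<Sum>k\<in>{1..p} - {j}. (a k * x k)\<^sup>2)"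
    by (intro sum_nonneg) auto
  show "quad a (x(j := t)) = (a j * t)\<^sup>2 + (\<Sum>k\<in>{1..p} - {j}. (a k * x k)\<^sup>2)" for t
    unfolding quad_def using assms by (subst sum.remove[of _ j]) (auto intro!: sum.cong)
qed

lemma shrink_stein:
  assumes j: "j \<in> {1..p}"
  shows "integrable P (shrink' a \<epsilon> j)"
    "has_bochner_integral P (\<lambda>x. (x j - \<theta> j) * shrink a \<epsilon> j x) (d j * integral\<^sup>L P (shrink' a \<epsilon> j))"
proof -
  have gm: "shrink a \<epsilon> j \<in> borel_measurable P" "shrink' a \<epsilon> j \<in> borel_measurable P"
    using j unfolding shrink_def[abs_def] shrink'_def[abs_def] by measurable
  have deriv: "((\<lambda>t. shrink a \<epsilon> j (x(j := t))) has_real_derivative shrink' a \<epsilon> j (x(j := t))) (at t)" for x t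
  proof -
    obtain r where r: "r \<ge> 0" "\<And>t. quad a (x(j := t)) = (a j * t)\<^sup>2 + r"
      using quad_upd[OF j] by blast
    have "0 < (a j * t)\<^sup>2 + r + \<epsilon>"
      using r(1) \<epsilon> by (simp add: add_nonneg_pos)
    then show ?thesis
      unfolding shrink_def shrink'_def r
      by (auto intro!: derivative_eq_intros simp: divide_simps) (simp add: algebra_simps power2_eq_square)
  qed
  have cont: "continuous_on UNIV (\<lambda>t. shrink' a \<epsilon> j (x(j := t)))" for x
  proof -
    obtain r where r: "r \<ge> 0" "\<And>t. quad a (x(j := t)) = (a j * t)\<^sup>2 + r"
      using quad_upd[OF j] by blast
    have "(a j * t)\<^sup>2 + r + \<epsilon> \<noteq> 0" for t
      using r(1) \<epsilon> zero_le_power2[of "a j * t"] by linarith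
    then show ?thesis
      unfolding shrink'_def r by (auto intro!: continuous_intros)
  qed
  show "integrable P (shrink' a \<epsilon> j)"
    "has_bochner_integral P (\<lambda>x. (x j - \<theta> j) * shrink a \<epsilon> j x) (d j * integral\<^sup>L P (shrink' a \<epsilon> j))"
    using stein_identity[OF j gm deriv cont shrink_bounded[OF j] shrink'_bounded[OF j]] by auto
qed

text \<open>The square is expanded, Stein's identity turns the cross term into a divergence, and
  \<open>stein_regularized_bound\<close> is integrated.\<close>

lemma regularized_risk_bound:
  assumes a: "\<And>j. j \<in> {1..p} \<Longrightarrow> a j \<ge> 0"
    and p: "p > 0"
    and c: "c = cstar p d a" "c \<ge> 0"
    and T: "(\<Sum>j\<in>{1..p}. (d j + (\<theta> j)\<^sup>2) * (a j)\<^sup>2) \<le> T" "T > 0"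
  shows "(\<integral>\<^sup>+ x. ennreal (\<Sum>j\<in>{1..p}. (x j - c * shrink a \<epsilon> j x - \<theta> j)\<^sup>2) \<partial>P)
    \<le> ennreal ((\<Sum>j\<in>{1..p}. d j) - c\<^sup>2 / (T + \<epsilon>))"
proof -
  interpret N: prob_space P by (rule prob_space_P)
  let ?I = "{1..p}"
  define m where "m = Max ((\<lambda>j. d j * a j) ` ?I)"
  \<comment> \<open>The tangent point is the bound \<open>T + \<epsilon>\<close> on the mean of
    \<open>quad a x + \<epsilon>\<close>; with this choice the integrated affine bound is at most
    \<open>- c\<^sup>2 / (T + \<epsilon>)\<close>.\<close>
  define \<mu> where "\<mu> = T + \<epsilon>"
  have \<mu>: "\<mu> > 0" using T \<epsilon> by (simp add: \<mu>_def)
  have w: "d j * a j \<le> m" if "j \<in> ?I" for j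
    unfolding m_def using that by (intro Max_ge) auto
  have "0 \<le> d 1 * a 1"
    using a[of 1] d_pos[of 1] p by auto
  then have m0: "m \<ge> 0"
    using w[of 1] p by simp
  have cm: "c = (\<Sum>j\<in>?I. d j * a j) - 2 * m"
    by (simp add: c cstar_def m_def)
  have sumg: "(\<Sum>j\<in>?I. (shrink a \<epsilon> j x)\<^sup>2) = quad a x / (quad a x + \<epsilon>)\<^sup>2" for x
    by (simp add: shrink_def quad_def power_divide sum_divide_distrib)
  have gm: "shrink a \<epsilon> j \<in> borel_measurable P" if "j \<in> ?I" for j
    using that unfolding shrink_def[abs_def] by measurable
  have g2_int: "integrable P (\<lambda>x. (shrink a \<epsilon> j x)\<^sup>2)" if "j \<in> ?I" for j
  proof (rule N.integrable_const_bound[where B="(1 + 1 / \<epsilon>)\<^sup>2"])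
    show "AE x in P. norm ((shrink a \<epsilon> j x)\<^sup>2) \<le> (1 + 1 / \<epsilon>)\<^sup>2"
      using shrink_bounded[OF that] by (auto intro!: always_eventually abs_le_square_iff[THEN iffD1] order_trans[OF _ abs_ge_self])
  qed (use gm[OF that] in measurable)
  let ?L = "\<lambda>x. \<Sum>j\<in>?I. (x j - c * shrink a \<epsilon> j x - \<theta> j)\<^sup>2"
  have L: "?L x = (\<Sum>j\<in>?I. (x j - \<theta> j)\<^sup>2 - 2 * c * ((x j - \<theta> j) * shrink a \<epsilon> j x) + c\<^sup>2 * (shrink a \<epsilon> j x)\<^sup>2)" for x
    by (intro sum.cong) (auto simp: power2_eq_square algebra_simps)
  have L_int: "has_bochner_integral P ?L
      (\<Sum>j\<in>?I. d j - 2 * c * (d j * integral\<^sup>L P (shrink' a \<epsilon> j)) + c\<^sup>2 * integral\<^sup>L P (\<lambda>x. (shrink a \<epsilon> j x)\<^sup>2))"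
    unfolding L
    by (intro has_bochner_integral_sum has_bochner_integral_add has_bochner_integral_diff
        has_bochner_integral_mult_right has_bochner_integral_coord_variance shrink_stein(2) has_bochner_integral_integrable g2_int)
  \<comment> \<open>\<open>?D\<close> differs pointwise from the excess of \<open>?L\<close> over
    the loss of \<open>X\<close> itself, but has the same expectation by Stein's identity.\<close>
  let ?D = "\<lambda>x. \<Sum>j\<in>?I. c\<^sup>2 * (shrink a \<epsilon> j x)\<^sup>2 - 2 * c * (d j * shrink' a \<epsilon> j x)"
  have D_int: "has_bochner_integral P ?D
      (\<Sum>j\<in>?I. c\<^sup>2 * integral\<^sup>L P (\<lambda>x. (shrink a \<epsilon> j x)\<^sup>2) - 2 * c * (d j * integral\<^sup>L P (shrink' a \<epsilon> j)))"
    by (intro has_bochner_integral_sum has_bochner_integral_diff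
        has_bochner_integral_mult_right has_bochner_integral_integrable g2_int shrink_stein(1))
  have quad_int: "has_bochner_integral P (quad a) (\<Sum>j\<in>?I. (a j)\<^sup>2 * (d j + (\<theta> j)\<^sup>2))"
    unfolding quad_def[abs_def] power_mult_distrib
    by (intro has_bochner_integral_sum has_bochner_integral_mult_right has_bochner_integral_coord_square)
  let ?E = "\<Sum>j\<in>?I. (a j)\<^sup>2 * (d j + (\<theta> j)\<^sup>2)"
  have "has_bochner_integral P (\<lambda>x. \<epsilon>) \<epsilon>" "has_bochner_integral P (\<lambda>x. 2) (2::real)"
    by (simp_all add: has_bochner_integral_iff N.prob_space)
  then have R_int: "has_bochner_integral P (\<lambda>x. - c\<^sup>2 * (2 / \<mu> - (quad a x + \<epsilon>) / \<mu>\<^sup>2))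
      (- c\<^sup>2 * (2 / \<mu> - (?E + \<epsilon>) / \<mu>\<^sup>2))"
    by (intro has_bochner_integral_mult_right has_bochner_integral_diff has_bochner_integral_divide_zero
        has_bochner_integral_add quad_int)
  have "?D x \<le> - c\<^sup>2 * (2 / \<mu> - (quad a x + \<epsilon>) / \<mu>\<^sup>2)" for x
  proof -
    have "?D x = c\<^sup>2 * (quad a x / (quad a x + \<epsilon>)\<^sup>2)
      - 2 * c * (\<Sum>j\<in>?I. (d j * a j) * (1 / (quad a x + \<epsilon>) - 2 * (a j * x j)\<^sup>2 / (quad a x + \<epsilon>)\<^sup>2))"
      by (simp add: sum_subtractf sumg[symmetric] sum_distrib_left shrink'_def mult.assoc)
    also have "\<dots> \<le> - c\<^sup>2 * (2 / \<mu> - (quad a x + \<epsilon>) / \<mu>\<^sup>2)"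
      using w m0 cm c(2) \<epsilon> \<mu> by (intro stein_regularized_bound) (auto simp: quad_def)
    finally show ?thesis .
  qed
  then have "integral\<^sup>L P ?D \<le> - c\<^sup>2 * (2 / \<mu> - (?E + \<epsilon>) / \<mu>\<^sup>2)"
    using D_int R_int by (metis (no_types, lifting) has_bochner_integral_iff integral_mono)
  also have "\<dots> \<le> - c\<^sup>2 * (2 / \<mu> - \<mu> / \<mu>\<^sup>2)"
  proof -
    have "?E + \<epsilon> \<le> \<mu>" using T by (simp add: \<mu>_def mult.commute)
    then have "(?E + \<epsilon>) / \<mu>\<^sup>2 \<le> \<mu> / \<mu>\<^sup>2" by (intro divide_right_mono) auto
    then have "c\<^sup>2 * (2 / \<mu> - \<mu> / \<mu>\<^sup>2) \<le> c\<^sup>2 * (2 / \<mu> - (?E + \<epsilon>) / \<mu>\<^sup>2)"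
      by (intro mult_left_mono) auto
    then show ?thesis by simp
  qed
  also have "\<dots> = - c\<^sup>2 / \<mu>"
    using \<mu> by (simp add: power2_eq_square field_simps)
  finally have D_le: "integral\<^sup>L P ?D \<le> - c\<^sup>2 / \<mu>" .
  have "integral\<^sup>L P ?L = (\<Sum>j\<in>?I. d j) + integral\<^sup>L P ?D"
    unfolding has_bochner_integral_integral_eq[OF L_int] has_bochner_integral_integral_eq[OF D_int]
    by (simp add: sum.distrib sum_subtractf)
  then have "integral\<^sup>L P ?L \<le> (\<Sum>j\<in>?I. d j) - c\<^sup>2 / (T + \<epsilon>)"
    using D_le by (simp add: \<mu>_def)
  moreover have "(\<integral>\<^sup>+ x. ennreal (?L x) \<partial>P) = ennreal (integral\<^sup>L P ?L)"
    using L_int by (intro nn_integral_eq_integral) (auto simp: has_bochner_integral_iff intro!: sum_nonneg)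
  ultimately show ?thesis
    by (simp add: ennreal_leI)
qed

end

section \<open>Removal of the regularization and the supremum over the parameter set\<close>

text \<open>The regularized losses converge at every point as \<open>\<epsilon>\<close> tends to 0.
  Only an upper bound on the limiting risk is wanted, so Fatou's lemma suffices.\<close>

lemma risk_delta_est_le:
  assumes a: "\<And>j. j \<in> {1..p} \<Longrightarrow> a j \<ge> 0"
    and p: "p > 0"
    and c: "cstar p d a \<ge> 0"
    and T: "(\<Sum>j\<in>{1..p}. (d j + (\<theta> j)\<^sup>2) * (a j)\<^sup>2) \<le> T" "T > 0"
  shows "risk p (delta_est p d a) \<theta> d \<le> ennreal ((\<Sum>j\<in>{1..p}. d j) - (cstar p d a)\<^sup>2 / T)"
proof -
  let ?I = "{1..p}"
  define c where "c = cstar p d a"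
  define \<epsilon> where "\<epsilon> n = 1 / real (Suc n)" for n
  have \<epsilon>: "\<epsilon> n > 0" for n
    by (simp add: \<epsilon>_def)
  have \<epsilon>0: "\<epsilon> \<longlonglongrightarrow> 0"
    unfolding \<epsilon>_def by (rule LIMSEQ_Suc) (rule lim_1_over_n)
  define u where "u n x = ennreal (\<Sum>j\<in>?I. (x j - c * shrink a (\<epsilon> n) j x - \<theta> j)\<^sup>2)" for n x
  have u_lim: "(\<lambda>n. u n x) \<longlonglongrightarrow> ennreal (\<Sum>j\<in>?I. (delta_est p d a x j - \<theta> j)\<^sup>2)" for x
  proof -
    have "(\<lambda>n. shrink a (\<epsilon> n) j x) \<longlonglongrightarrow> a j * x j / quad a x" if "j \<in> ?I" for j
    proof (cases "quad a x = 0")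
      \<comment> \<open>Here \<open>a j * x j = 0\<close>, so every regularized term is 0, and the
        limit is 0 as well under the convention that division by zero gives 0. Hence no null set has
        to be excluded.\<close>
      case True
      then have "a j * x j = 0"
        using coord_le_quad[OF \<epsilon> that, of a x] by simp
      then show ?thesis
        by (auto simp: shrink_def)
    next
      case False
      then have "(\<lambda>n. a j * x j / (quad a x + \<epsilon> n)) \<longlonglongrightarrow> a j * x j / (quad a x + 0)"
        by (intro tendsto_intros \<epsilon>0) auto
      then show ?thesis
        by (simp add: shrink_def)
    qed
    then have "(\<lambda>n. u n x) \<longlonglongrightarrow> ennreal (\<Sum>j\<in>?I. (x j - c * (a j * x j / quad a x) - \<theta> j)\<^sup>2)"
      unfolding u_def by (intro tendsto_ennrealI tendsto_intros) auto
    then show ?thesis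
      by (simp add: delta_est_def quad_def c_def)
  qed
  have u_meas: "u n \<in> borel_measurable P" for n
    unfolding u_def[abs_def] shrink_def using quad_measurable[OF \<epsilon>, of a] by measurable
  have "risk p (delta_est p d a) \<theta> d = (\<integral>\<^sup>+ x. liminf (\<lambda>n. u n x) \<partial>P)"
    unfolding risk_def using u_lim
    by (intro nn_integral_cong lim_imp_Liminf[symmetric]) auto
  also have "\<dots> \<le> liminf (\<lambda>n. integral\<^sup>N P (u n))"
    by (intro nn_integral_liminf u_meas)
  also have "\<dots> \<le> liminf (\<lambda>n. ennreal ((\<Sum>j\<in>?I. d j) - c\<^sup>2 / (T + \<epsilon> n)))"
    unfolding u_def using a p c T
    by (intro Liminf_mono always_eventually allI regularized_risk_bound \<epsilon>) (auto simp: c_def)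
  also have "\<dots> = ennreal ((\<Sum>j\<in>?I. d j) - c\<^sup>2 / T)"
  proof (rule lim_imp_Liminf)
    have "(\<lambda>n. (\<Sum>j\<in>?I. d j) - c\<^sup>2 / (T + \<epsilon> n)) \<longlonglongrightarrow> (\<Sum>j\<in>?I. d j) - c\<^sup>2 / (T + 0)"
      using T by (intro tendsto_intros \<epsilon>0) auto
    then show "(\<lambda>n. ennreal ((\<Sum>j\<in>?I. d j) - c\<^sup>2 / (T + \<epsilon> n))) \<longlonglongrightarrow> ennreal ((\<Sum>j\<in>?I. d j) - c\<^sup>2 / T)"
      by (intro tendsto_ennrealI) simp
  qed simp
  finally show ?thesis
    by (simp add: c_def)
qed

end

text \<open>On \<open>H_set p \<gamma>\<close> the mean of the squared norm of \<open>A X\<close> is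
  at most the constrained sum \<open>\<Sum> (d j + \<gamma> j) * (a j)\<^sup>2\<close>. The
  constraint fixes that sum, which gives one \<open>T\<close> for all
  \<open>\<theta>\<close>.\<close>

lemma max_risk_delta_est_le:
  assumes d: "\<forall>j\<in>{1..p}. d j > 0" and p: "p > 0"
    and feas: "feasible p d \<gamma> a" and T: "(\<Sum>j\<in>{1..p}. dstar d \<gamma> j) > 0"
    and c: "cstar p d a \<ge> 0"
  shows "max_risk p (delta_est p d a) d \<gamma>
    \<le> ennreal ((\<Sum>j\<in>{1..p}. d j) - (cstar p d a)\<^sup>2 / (\<Sum>j\<in>{1..p}. dstar d \<gamma> j))"
  unfolding max_risk_def
proof (rule SUP_least)
  fix \<theta> assume \<theta>: "\<theta> \<in> H_set p \<gamma>"
  \<comment> \<open>The locale wants every \<open>d j\<close> positive, also outside the index range.\<close>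
  define d' where "d' j = (if j \<in> {1..p} then d j else 1)" for j
  interpret diag_normal p \<theta> d'
    using d by unfold_locales (auto simp: d'_def)
  have d'_eq: "d' j = d j" if "j \<in> {1..p}" for j
    using that by (simp add: d'_def)
  have cs: "cstar p d' a = cstar p d a"
    unfolding cstar_def using d'_eq
    by (intro arg_cong2[of _ _ _ _ minus] arg_cong[of _ _ "\<lambda>A. 2 * Max A"] sum.cong image_cong) auto
  have "normal_diag p \<theta> d' = normal_diag p \<theta> d"
    unfolding normal_diag_def by (intro PiM_cong) (auto simp: d'_def)
  moreover have "delta_est p d' a = delta_est p d a"
    by (simp add: delta_est_def[abs_def] cs)
  moreover have "(\<Sum>j\<in>{1..p}. d' j) = (\<Sum>j\<in>{1..p}. d j)"
    using d'_eq by simp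
  moreover have "(\<Sum>j\<in>{1..p}. (d' j + (\<theta> j)\<^sup>2) * (a j)\<^sup>2) \<le> (\<Sum>j\<in>{1..p}. (d j + \<gamma> j) * (a j)\<^sup>2)"
    using \<theta> by (intro sum_mono mult_right_mono) (auto simp: d'_def H_set_def)
  ultimately show "risk p (delta_est p d a) \<theta> d
      \<le> ennreal ((\<Sum>j\<in>{1..p}. d j) - (cstar p d a)\<^sup>2 / (\<Sum>j\<in>{1..p}. dstar d \<gamma> j))"
    using risk_delta_est_le[of a "\<Sum>j\<in>{1..p}. dstar d \<gamma> j"] feas p T c
    by (simp add: cs feasible_def risk_def)
qed

section \<open>The maximizer as a truncation at a water level\<close>

text \<open>Intermediate value theorem: the sum is 0 at \<open>m = s 1\<close> and equals
  \<open>p\<close>, which exceeds 2, at \<open>m = 0\<close>.\<close>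

lemma exists_water_level:
  fixes s :: "nat \<Rightarrow> real"
  assumes p: "p \<ge> 3" and s: "\<And>j. j \<in> {1..p} \<Longrightarrow> s j > 0"
    and mono: "\<And>j. j \<in> {1..p} \<Longrightarrow> s j \<le> s 1"
  obtains m where "0 < m" "m \<le> s 1" "(\<Sum>j\<in>{1..p}. 1 - min (s j) m / s j) = 2"
proof -
  let ?f = "\<lambda>m. \<Sum>j\<in>{1..p}. 1 - min (s j) m / s j"
  have s1: "s 1 > 0" using s[of 1] p by auto
  have "1 - min (s j) (s 1) / s j = 0" if "j \<in> {1..p}" for j
    using s[OF that] mono[OF that] by (simp add: min_absorb1)
  then have f1: "?f (s 1) = 0"
    by (intro sum.neutral) blast
  have "1 - min (s j) 0 / s j = 1" if "j \<in> {1..p}" for j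
    using s[OF that] by (simp add: min_absorb2)
  then have "?f 0 = (\<Sum>j\<in>{1..p}. 1)"
    by (intro sum.cong) auto
  then have f0: "?f 0 = real p" by simp
  have "\<forall>j\<in>{1..p}. s j \<noteq> 0" using s by fastforce
  then have "continuous_on {0..s 1} ?f"
    by (auto intro!: continuous_intros)
  then obtain m where m: "0 \<le> m" "m \<le> s 1" "?f m = 2"
    using IVT2'[of ?f "s 1" 2 0] f0 f1 p s1 by auto
  moreover have "m \<noteq> 0" using m(3) f0 p by auto
  ultimately show ?thesis using that[of m] by linarith
qed

lemma dstar_pos: "d j > 0 \<Longrightarrow> \<gamma> j \<ge> 0 \<Longrightarrow> dstar d \<gamma> j > 0"
  by (simp add: dstar_def add_pos_nonneg)

lemma feasible_iff_weighted:
  assumes d: "\<forall>j\<in>{1..p}. d j > 0" and \<gamma>: "\<forall>j\<in>{1..p}. \<gamma> j \<ge> 0"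
  shows "feasible p d \<gamma> a \<longleftrightarrow> (\<forall>j\<in>{1..p}. a j \<ge> 0) \<and>
    (\<Sum>j\<in>{1..p}. (d j * a j)\<^sup>2 / dstar d \<gamma> j) = (\<Sum>j\<in>{1..p}. dstar d \<gamma> j)"
proof -
  have "(d j + \<gamma> j) * (a j)\<^sup>2 = (d j * a j)\<^sup>2 / dstar d \<gamma> j" if "j \<in> {1..p}" for j
  proof -
    have "d j > 0" "d j + \<gamma> j > 0"
      using that d \<gamma> by (auto intro: add_pos_nonneg)
    then show ?thesis by (simp add: dstar_def field_simps)
  qed
  then have "(\<Sum>j\<in>{1..p}. (d j + \<gamma> j) * (a j)\<^sup>2) = (\<Sum>j\<in>{1..p}. (d j * a j)\<^sup>2 / dstar d \<gamma> j)"
    by (intro sum.cong) auto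
  then show ?thesis
    by (simp add: feasible_def)
qed

text \<open>The weights \<open>1 - w j\<close> are nonnegative with total 2, so they average the
  values \<open>d j * b j\<close> to at most twice the maximum. This bounds \<open>cstar\<close> by
  a linear functional.\<close>

lemma cstar_le_weighted:
  assumes w: "\<And>j. j \<in> {1..p} \<Longrightarrow> w j \<le> 1" "(\<Sum>j\<in>{1..p}. 1 - w j) = 2"
  shows "cstar p d b \<le> (\<Sum>j\<in>{1..p}. w j * (d j * b j))"
proof -
  let ?M = "Max ((\<lambda>j. d j * b j) ` {1..p})"
  have "(\<Sum>j\<in>{1..p}. (1 - w j) * (d j * b j)) \<le> (\<Sum>j\<in>{1..p}. (1 - w j) * ?M)"
    using w(1) by (intro sum_mono mult_left_mono Max_ge) auto
  also have "\<dots> = 2 * ?M"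
    unfolding sum_distrib_right[symmetric] w(2) ..
  finally show ?thesis
    by (simp add: cstar_def left_diff_distrib sum_subtractf)
qed

text \<open>The linear bound for the weights \<open>w = min s m / s\<close> is tight at the scaled
  truncation \<open>l * min s m\<close>. A maximizer does at least as well as this competitor, and
  equality in Cauchy--Schwarz then forces it to coincide with it on \<open>{1..p}\<close>; the value
  and \<open>\<nu>\<close> are read off from there.\<close>

lemma maximizer_value:
  assumes p: "p \<ge> 3" and d: "\<forall>j\<in>{1..p}. d j > 0" and \<gamma>: "\<forall>j\<in>{1..p}. \<gamma> j \<ge> 0"
    and sorted: "\<forall>i j. 1 \<le> i \<longrightarrow> i \<le> j \<longrightarrow> j \<le> p \<longrightarrow> dstar d \<gamma> j \<le> dstar d \<gamma> i"
    and max: "is_maximizer p d \<gamma> a"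
  obtains m where "m > 0" "nu_idx p d a \<in> {1..p}" "m \<le> dstar d \<gamma> (nu_idx p d a)"
    "(\<Sum>j\<in>{1..nu_idx p d a}. m / dstar d \<gamma> j) = real (nu_idx p d a) - 2"
    "cstar p d a \<ge> 0"
    "(cstar p d a)\<^sup>2 / (\<Sum>j\<in>{1..p}. dstar d \<gamma> j)
      = m * (real (nu_idx p d a) - 2) + (\<Sum>j\<in>{nu_idx p d a<..p}. dstar d \<gamma> j)"
proof -
  define s where "s = dstar d \<gamma>"
  let ?I = "{1..p}"
  have s_pos: "s j > 0" if "j \<in> ?I" for j
    using d \<gamma> that by (simp add: s_def dstar_pos)
  obtain m where m: "0 < m" "m \<le> s 1" and level: "(\<Sum>j\<in>?I. 1 - min (s j) m / s j) = 2"
    using exists_water_level[of p s] p s_pos sorted unfolding s_def by auto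
  define u where "u j = min (s j) m" for j
  define w where "w j = u j / s j" for j
  define K where "K = (\<Sum>j\<in>?I. w j * u j)"
  define T where "T = (\<Sum>j\<in>?I. s j)"
  \<comment> \<open>The scale that puts \<open>l * u\<close> on the constraint surface, where
    \<open>K\<close> is the weighted square sum of \<open>u\<close>.\<close>
  define l where "l = sqrt (T / K)"
  have one: "1 \<in> ?I" using p by simp
  have u_pos: "u j > 0" if "j \<in> ?I" for j
    using s_pos[OF that] m by (simp add: u_def)
  have w: "w j \<le> 1" "w j > 0" if "j \<in> ?I" for j
    using s_pos[OF that] u_pos[OF that] by (auto simp: w_def u_def)
  have wsum: "(\<Sum>j\<in>?I. 1 - w j) = 2"
    using level by (simp add: w_def u_def)
  have K: "K > 0"
    unfolding K_def using one u_pos w by (intro sum_pos) (auto intro!: mult_pos_pos)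
  have T: "T > 0"
    unfolding T_def using one s_pos by (intro sum_pos) auto
  have l: "l > 0" "l\<^sup>2 * K = T"
    using K T by (auto simp: l_def)
  have u_max: "Max ((\<lambda>j. d j * b j) ` ?I) = l * m" if "\<And>j. j \<in> ?I \<Longrightarrow> d j * b j = l * u j" for b
  proof (rule Max_eqI)
    have "d 1 * b 1 = l * m"
      using that[OF one] m by (simp add: u_def)
    then show "l * m \<in> (\<lambda>j. d j * b j) ` ?I"
      using one by force
  qed (use that l in \<open>auto simp: u_def\<close>)
  \<comment> \<open>Complementary slackness: at each index either \<open>w j = 1\<close> or
    \<open>u j = m\<close>, so the bound of \<open>cstar_le_weighted\<close> is an equality for
    \<open>u\<close>.\<close>
  have wu: "(\<Sum>j\<in>?I. u j) - 2 * m = K"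
  proof -
    have "(1 - w j) * u j = (1 - w j) * m" if "j \<in> ?I" for j
      using s_pos[OF that] by (auto simp: w_def u_def min_def)
    then have "(\<Sum>j\<in>?I. (1 - w j) * u j) = (\<Sum>j\<in>?I. (1 - w j) * m)"
      by (intro sum.cong) auto
    also have "\<dots> = 2 * m"
      unfolding sum_distrib_right[symmetric] wsum ..
    finally show ?thesis
      by (simp add: K_def left_diff_distrib sum_subtractf)
  qed
  have cstar_lu: "cstar p d b = l * K" if "\<And>j. j \<in> ?I \<Longrightarrow> d j * b j = l * u j" for b
  proof -
    have "(\<Sum>j\<in>?I. d j * b j) = l * (\<Sum>j\<in>?I. u j)"
      unfolding sum_distrib_left using that by (intro sum.cong) auto
    moreover have "Max ((\<lambda>j. d j * b j) ` ?I) = l * m"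
      using that by (rule u_max)
    ultimately show ?thesis
      unfolding cstar_def wu[symmetric] by (simp add: right_diff_distrib)
  qed
  have uu: "(\<Sum>j\<in>?I. (u j)\<^sup>2 / s j) = K"
    by (simp add: K_def w_def power2_eq_square)
  \<comment> \<open>The competitor: the diagonal matrix whose products \<open>d j * b j\<close> are
    \<open>l * u j\<close>.\<close>
  define b where "b j = l * u j / d j" for j
  have b: "d j * b j = l * u j" if "j \<in> ?I" for j
    using bspec[OF d that] by (simp add: b_def)
  have "(\<Sum>j\<in>?I. (d j * b j)\<^sup>2 / s j) = (\<Sum>j\<in>?I. l\<^sup>2 * ((u j)\<^sup>2 / s j))"
    using b by (intro sum.cong) (auto simp: power_mult_distrib)
  then have "(\<Sum>j\<in>?I. (d j * b j)\<^sup>2 / s j) = T"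
    unfolding sum_distrib_left[symmetric] uu l(2) .
  moreover have "b j \<ge> 0" if "j \<in> ?I" for j
    using d l u_pos[OF that] that by (simp add: b_def less_imp_le)
  ultimately have "feasible p d \<gamma> b"
    by (simp add: feasible_iff_weighted[OF d \<gamma>] T_def s_def)
  then have "l * K \<le> cstar p d a"
    using max cstar_lu[of b] b by (auto simp: is_maximizer_def)
  also have "\<dots> \<le> (\<Sum>j\<in>?I. w j * (d j * a j))"
    using w wsum by (intro cstar_le_weighted) auto
  finally have ip: "l * K \<le> (\<Sum>j\<in>?I. w j * (d j * a j))" .
  have aT: "(\<Sum>j\<in>?I. (d j * a j)\<^sup>2 / s j) = T"
    using max by (simp add: is_maximizer_def feasible_iff_weighted[OF d \<gamma>] T_def s_def)
  have a: "d j * a j = l * u j" if "j \<in> ?I" for j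
  proof -
    have nn: "0 \<le> (d j * a j - l * u j)\<^sup>2 / s j" if "j \<in> ?I" for j
      using s_pos[OF that] by simp
    \<comment> \<open>Equality in Cauchy--Schwarz, made explicit: both vectors have weighted square
      sum \<open>T\<close>, and \<open>ip\<close> says that their weighted inner product is at least
      \<open>T\<close>, so their weighted distance is zero.\<close>
    have "(\<Sum>j\<in>?I. (d j * a j - l * u j)\<^sup>2 / s j)
        = (\<Sum>j\<in>?I. (d j * a j)\<^sup>2 / s j - 2 * l * (w j * (d j * a j)) + l\<^sup>2 * ((u j)\<^sup>2 / s j))"
      by (intro sum.cong) (auto simp: w_def power2_eq_square algebra_simps add_divide_distrib diff_divide_distrib)
    also have "\<dots> = T - 2 * l * (\<Sum>j\<in>?I. w j * (d j * a j)) + l\<^sup>2 * K"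
      unfolding sum.distrib sum_subtractf sum_distrib_left[symmetric] aT uu ..
    also have "\<dots> \<le> T - 2 * l * (l * K) + l\<^sup>2 * K"
      using ip l by simp
    also have "\<dots> = 0"
      using l(2) by (simp add: power2_eq_square)
    finally have "(\<Sum>j\<in>?I. (d j * a j - l * u j)\<^sup>2 / s j) = 0"
      using nn by (intro antisym sum_nonneg) auto
    then have "(d j * a j - l * u j)\<^sup>2 / s j = 0"
      using that nn by (subst (asm) sum_nonneg_eq_0_iff) auto
    then show ?thesis
      using s_pos[OF that] by simp
  qed
  define n where "n = nu_idx p d a"
  \<comment> \<open>The maximum \<open>l * m\<close> is attained exactly where the truncation is
    active, so \<open>\<nu>\<close> is the last index with \<open>m \<le> s j\<close>; by sortedness
    all earlier indices are truncated as well.\<close>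
  have u_iff: "d j * a j = Max ((\<lambda>k. d k * a k) ` ?I) \<longleftrightarrow> m \<le> s j" if "j \<in> ?I" for j
    using a[OF that] u_max[of a, OF a] l by (auto simp: u_def min_def)
  have n_eq: "n = (GREATEST j. j \<in> ?I \<and> m \<le> s j)"
    unfolding n_def nu_idx_def using u_iff by (intro arg_cong[of _ _ Greatest] ext) auto
  have n: "n \<in> ?I \<and> m \<le> s n"
    unfolding n_eq by (rule GreatestI_nat[where k=1 and b=p]) (use one m in auto)
  have n_max: "j \<le> n" if "j \<in> ?I" "m \<le> s j" for j
    unfolding n_eq by (rule Greatest_le_nat[where b=p]) (use that in auto)
  have u_le: "u j = m" if "j \<in> {1..n}" for j
    using sorted that n by (force simp: u_def s_def min_def)
  have u_gt: "u j = s j" if "j \<in> {n<..p}" for j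
    using n_max[of j] that by (force simp: u_def min_def)
  have split: "?I = {1..n} \<union> {n<..p}" "{1..n} \<inter> {n<..p} = {}"
    using n by auto
  have sum_split: "sum f ?I = sum f {1..n} + sum f {n<..p}" for f :: "nat \<Rightarrow> real"
    unfolding split(1) using split(2) by (intro sum.union_disjoint) auto
  have w_le: "w j = m / s j" if "j \<in> {1..n}" for j
    using u_le[OF that] by (simp add: w_def)
  have w_gt: "w j = 1" if "j \<in> {n<..p}" for j
    using u_gt[OF that] s_pos[of j] that by (auto simp: w_def)
  have lev: "(\<Sum>j\<in>{1..n}. m / s j) = real n - 2"
  proof -
    have "2 = (\<Sum>j\<in>{1..n}. 1 - m / s j) + (\<Sum>j\<in>{n<..p}. 0)"
      unfolding wsum[symmetric] sum_split
      by (intro arg_cong2[of _ _ _ _ plus] sum.cong) (auto simp: w_le w_gt)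
    then show ?thesis
      by (simp add: sum_subtractf)
  qed
  have "K = m * (\<Sum>j\<in>{1..n}. m / s j) + (\<Sum>j\<in>{n<..p}. s j)"
    unfolding K_def sum_split sum_distrib_left
    by (intro arg_cong2[of _ _ _ _ plus] sum.cong) (auto simp: w_le w_gt u_le u_gt)
  then have K_eq: "K = m * (real n - 2) + (\<Sum>j\<in>{n<..p}. s j)"
    using lev by simp
  have c: "cstar p d a = l * K"
    using a by (rule cstar_lu)
  \<comment> \<open>One factor \<open>l\<^sup>2 * K\<close> is \<open>T\<close>, so dividing by
    \<open>T\<close> leaves \<open>K\<close>.\<close>
  have "(l * K)\<^sup>2 = K * T"
    using l(2)[symmetric] by (simp add: power2_eq_square)
  then have "(cstar p d a)\<^sup>2 / T = K"
    using T by (simp add: c)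
  moreover have "cstar p d a \<ge> 0"
    using c l K by simp
  ultimately show ?thesis
    using that[of m] m n lev K_eq unfolding n_def s_def T_def by simp
qed

section \<open>An inequality for the water level\<close>

text \<open>After scaling by \<open>m\<close>, the numbers \<open>e j = 1 - 1 / t j\<close> are
  nonnegative, nonincreasing and sum to 2. Writing \<open>t j = 1 + t j * e j\<close> and bounding
  the factor \<open>t j\<close> by \<open>x = t 5\<close> reduces the tail sum to
  \<open>x * E\<close> with \<open>E\<close> the tail of the \<open>e j\<close>. Monotonicity gives
  two bounds on \<open>E\<close> in terms of \<open>e 5\<close>, which cross at
  \<open>x = n / (n - 2)\<close>.\<close>

lemma water_level_bound:
  fixes s :: "nat \<Rightarrow> real"
  assumes n: "n \<ge> 4" and m: "m > 0" "m \<le> s n"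
    and sorted: "\<And>i j. 1 \<le> i \<Longrightarrow> i \<le> j \<Longrightarrow> j \<le> n \<Longrightarrow> s j \<le> s i"
    and level: "(\<Sum>j\<in>{1..n}. m / s j) = real n - 2"
  shows "(\<Sum>j\<in>{5..n}. s j) + 4 * s n / real n \<le> m * (real n - 2)"
proof -
  define t where "t j = s j / m" for j
  define e where "e j = 1 - 1 / t j" for j
  have t1: "t j \<ge> 1" if "1 \<le> j" "j \<le> n" for j
    using sorted[OF that(1,2)] m that by (auto simp: t_def intro: order_trans)
  have t_mono: "t j \<le> t i" if "1 \<le> i" "i \<le> j" "j \<le> n" for i j
    using sorted[OF that] m by (auto simp: t_def intro: divide_right_mono)
  have e_mono: "e j \<le> e i" if "1 \<le> i" "i \<le> j" "j \<le> n" for i j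
    using t_mono[OF that] t1[of j] t1[of i] that by (auto simp: e_def intro!: divide_left_mono mult_pos_pos)
  have e0: "e j \<ge> 0" if "1 \<le> j" "j \<le> n" for j
    using t1[OF that] by (simp add: e_def)
  have "(\<Sum>j\<in>{1..n}. 1 / t j) = real n - 2"
    using level by (simp add: t_def)
  then have sum_e: "(\<Sum>j\<in>{1..n}. e j) = 2"
    by (simp add: e_def sum_subtractf)
  \<comment> \<open>The last \<open>e n\<close> is the smallest, hence at most the average
    \<open>2 / n\<close>; in terms of \<open>t\<close> this is
    \<open>t n \<le> n / (n - 2)\<close>.\<close>
  have "real n * e n = (\<Sum>j\<in>{1..n}. e n)"
    by simp
  also have "\<dots> \<le> (\<Sum>j\<in>{1..n}. e j)"
    using e_mono by (intro sum_mono) auto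
  finally have "real n * e n \<le> 2"
    using sum_e by simp
  then have "real n * (1 - 1 / t n) * t n \<le> 2 * t n"
    using t1[of n] n by (intro mult_right_mono) (auto simp: e_def)
  then have tn: "t n * (real n - 2) \<le> real n"
    using t1[of n] n by (simp add: field_simps)
  have "(\<Sum>j\<in>{5..n}. t j) + 4 * t n / real n \<le> real n - 2"
  proof (cases "n = 4")
    \<comment> \<open>The tail from 5 is empty and \<open>tn\<close> alone gives the claim; there is
      no \<open>t 5\<close> to compare with.\<close>
    case True
    then show ?thesis using tn by simp
  next
    case False
    then have n5: "n \<ge> 5" using n by simp
    define x where "x = t 5"
    define E where "E = (\<Sum>j\<in>{5..n}. e j)"
    have x1: "x \<ge> 1" using t1[of 5] n5 by (simp add: x_def)
    have xe: "x * e 5 = x - 1" using x1 by (simp add: e_def x_def[symmetric] field_simps)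
    have "(\<Sum>j\<in>{5..n}. t j) \<le> (\<Sum>j\<in>{5..n}. 1 + x * e j)"
    proof (rule sum_mono)
      fix j assume j: "j \<in> {5..n}"
      have "t j = 1 + t j * e j"
        using t1[of j] j by (simp add: e_def field_simps)
      also have "\<dots> \<le> 1 + x * e j"
        using t_mono[of 5 j] e0[of j] j unfolding x_def by (intro add_left_mono mult_right_mono) auto
      finally show "t j \<le> 1 + x * e j" .
    qed
    also have "\<dots> = (real n - 4) + x * E"
      using n5 by (simp add: sum.distrib E_def sum_distrib_left of_nat_diff)
    finally have St: "(\<Sum>j\<in>{5..n}. t j) \<le> (real n - 4) + x * E" .
    have "E \<le> (\<Sum>j\<in>{5..n}. e 5)"
      unfolding E_def using e_mono by (intro sum_mono) auto
    then have E1: "E \<le> (real n - 4) * e 5"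
      using n5 by (simp add: of_nat_diff)
    have un: "{1..n} = {1..4} \<union> {5..n}" "{1..4} \<inter> {5..n} = {}"
      using n5 by auto
    have "(\<Sum>j\<in>{1..n}. e j) = (\<Sum>j\<in>{1..4}. e j) + E"
      unfolding un(1) E_def using un(2) by (intro sum.union_disjoint) auto
    moreover have "(\<Sum>j\<in>{1..4::nat}. e 5) \<le> (\<Sum>j\<in>{1..4}. e j)"
      using e_mono n5 by (intro sum_mono) auto
    ultimately have E2: "E \<le> 2 - 4 * e 5"
      using sum_e by simp
    have n2: "real n - 2 > 0" using n5 by simp
    have ratio: "real n / (real n - 2) = 1 + 2 / (real n - 2)" using n2 by (simp add: field_simps)
    show ?thesis
    proof (cases "real n \<le> x * (real n - 2)")
      \<comment> \<open>For large \<open>x\<close> the bound \<open>E2\<close> is the sharper one.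
        It yields \<open>4 - 2 * x\<close>, decreasing in \<open>x\<close>, so the worst case is the
        crossing point.\<close>
      case True
      have "x * E \<le> x * (2 - 4 * e 5)"
        using E2 x1 by (intro mult_left_mono) auto
      also have "\<dots> = 4 - 2 * x"
        using xe by (simp add: algebra_simps)
      finally have xE: "x * E \<le> 4 - 2 * x" .
      have "4 * t n / real n \<le> 4 / (real n - 2)"
        using tn n2 n5 by (simp add: field_simps)
      moreover have "real n / (real n - 2) \<le> x"
        using True n2 by (simp add: field_simps)
      moreover have "4 - 2 * (real n / (real n - 2)) + 4 / (real n - 2) = 2"
        unfolding ratio by simp
      ultimately show ?thesis using St xE by linarith
    next
      \<comment> \<open>For small \<open>x\<close> the bound \<open>E1\<close> is the sharper one.
        It yields \<open>(n - 4) * (x - 1)\<close>, increasing in \<open>x\<close>, so the worst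
        case is again the crossing point, with the same total 2.\<close>
      case False
      have "x * E \<le> x * ((real n - 4) * e 5)"
        using E1 x1 by (intro mult_left_mono) auto
      also have "\<dots> = (real n - 4) * (x - 1)"
        by (simp add: xe[symmetric])
      finally have xE: "x * E \<le> (real n - 4) * (x - 1)" .
      have xr: "x \<le> real n / (real n - 2)"
        using False n2 by (simp add: field_simps)
      have "4 * t n / real n \<le> 4 * x / real n"
        using t_mono[of 5 n] n5 unfolding x_def by (intro divide_right_mono) auto
      also have "\<dots> \<le> 4 * (real n / (real n - 2)) / real n"
        using xr by (intro divide_right_mono mult_left_mono) auto
      also have "\<dots> = 4 / (real n - 2)"
        using n5 by simp
      finally have 4: "4 * t n / real n \<le> 4 / (real n - 2)" .
      have "(real n - 4) * (x - 1) \<le> (real n - 4) * (2 / (real n - 2))"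
        using xr n5 unfolding ratio by (intro mult_left_mono) auto
      moreover have "(real n - 4) * (2 / (real n - 2)) + 4 / (real n - 2) = 2"
        using n2 by (auto simp: divide_simps)
      ultimately show ?thesis using St xE 4 by linarith
    qed
  qed
  then have "m * ((\<Sum>j\<in>{5..n}. t j) + 4 * t n / real n) \<le> m * (real n - 2)"
    using m by (intro mult_left_mono) auto
  moreover have "m * (\<Sum>j\<in>{5..n}. t j) = (\<Sum>j\<in>{5..n}. s j)" "m * (4 * t n / real n) = 4 * s n / real n"
    using m by (simp_all add: t_def sum_distrib_left)
  ultimately show ?thesis
    by (simp only: distrib_left)
qed

section \<open>The two bounds on the maximal risk\<close>

theorem theorem4:
  fixes p :: nat and d \<gamma> a :: "nat \<Rightarrow> real"
  assumes "p \<ge> 3"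
    and "\<forall>j\<in>{1..p}. d j > 0"
    and "\<forall>j\<in>{1..p}. \<gamma> j \<ge> 0"
    and "\<forall>i j. 1 \<le> i \<longrightarrow> i \<le> j \<longrightarrow> j \<le> p \<longrightarrow> dstar d \<gamma> j \<le> dstar d \<gamma> i"
    and "is_maximizer p d \<gamma> a"
  shows "(nu_idx p d a = 3 \<longrightarrow>
            max_risk p (delta_est p d a) d \<gamma>
              \<le> ennreal ((\<Sum>j\<in>{1..p}. d j) - (\<Sum>j\<in>{3..p}. dstar d \<gamma> j) + 2/3 * dstar d \<gamma> 3))
       \<and> (nu_idx p d a \<ge> 4 \<longrightarrow>
            max_risk p (delta_est p d a) d \<gamma>
              \<le> ennreal ((\<Sum>j\<in>{1..p}. d j) - (\<Sum>j\<in>{3..p}. dstar d \<gamma> j)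
                  + (dstar d \<gamma> 3 + dstar d \<gamma> 4 - 4 * dstar d \<gamma> (nu_idx p d a) / real (nu_idx p d a)))
          \<and> (\<Sum>j\<in>{1..p}. d j) - (\<Sum>j\<in>{3..p}. dstar d \<gamma> j)
                  + (dstar d \<gamma> 3 + dstar d \<gamma> 4 - 4 * dstar d \<gamma> (nu_idx p d a) / real (nu_idx p d a))
              \<le> (\<Sum>j\<in>{1..p}. d j) - (\<Sum>j\<in>{3..p}. dstar d \<gamma> j) + (dstar d \<gamma> 3 + dstar d \<gamma> 4))"
proof -
  let ?s = "dstar d \<gamma>"
  define n where "n = nu_idx p d a"
  obtain m where m: "m > 0" "n \<in> {1..p}" "m \<le> ?s n"
    and level: "(\<Sum>j\<in>{1..n}. m / ?s j) = real n - 2" and c: "cstar p d a \<ge> 0"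
    and val: "(cstar p d a)\<^sup>2 / (\<Sum>j\<in>{1..p}. ?s j) = m * (real n - 2) + (\<Sum>j\<in>{n<..p}. ?s j)"
    using maximizer_value[OF assms] unfolding n_def by blast
  have s_pos: "?s j > 0" if "j \<in> {1..p}" for j
    using assms(2,3) that by (simp add: dstar_pos)
  have "(\<Sum>j\<in>{1..p}. ?s j) > 0"
    using assms(1) s_pos by (intro sum_pos) auto
  then have risk: "max_risk p (delta_est p d a) d \<gamma>
      \<le> ennreal ((\<Sum>j\<in>{1..p}. d j) - (m * (real n - 2) + (\<Sum>j\<in>{n<..p}. ?s j)))"
    using max_risk_delta_est_le[OF assms(2), of \<gamma> a] assms(1,5) c
    unfolding val by (simp add: is_maximizer_def)
  have three: "(\<Sum>j\<in>{3..p}. ?s j) = (\<Sum>j\<in>{3..n}. ?s j) + (\<Sum>j\<in>{n<..p}. ?s j)" if "n \<ge> 3"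
  proof -
    have "{3..p} = {3..n} \<union> {n<..p}" using that m(2) by auto
    then show ?thesis by (simp add: sum.union_disjoint ivl_disj_int)
  qed
  have case3: "max_risk p (delta_est p d a) d \<gamma>
      \<le> ennreal ((\<Sum>j\<in>{1..p}. d j) - (\<Sum>j\<in>{3..p}. ?s j) + 2/3 * ?s 3)" if n3: "n = 3"
  proof -
    \<comment> \<open>For \<open>n = 3\<close> the claim amounts to \<open>?s 3 / 3 \<le> m\<close>.
      The three ratios sum to 1, and the third is the largest because \<open>?s 3\<close> is the
      smallest denominator.\<close>
    have "1 = (\<Sum>j\<in>{1..3::nat}. m / ?s j)"
      using level n3 by simp
    also have "\<dots> \<le> (\<Sum>j\<in>{1..3::nat}. m / ?s 3)"
      using assms(1,4) m(1) s_pos by (intro sum_mono divide_left_mono) (auto intro!: mult_pos_pos)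
    finally have "?s 3 \<le> 3 * m"
      using s_pos[of 3] assms(1) by (simp add: field_simps)
    then show ?thesis
      using three by (intro order_trans[OF risk] ennreal_leI) (simp add: n3)
  qed
  have case4: "max_risk p (delta_est p d a) d \<gamma>
      \<le> ennreal ((\<Sum>j\<in>{1..p}. d j) - (\<Sum>j\<in>{3..p}. ?s j) + (?s 3 + ?s 4 - 4 * ?s n / real n))"
    if n4: "n \<ge> 4"
  proof -
    \<comment> \<open>Once the terms beyond \<open>n\<close> and those with indices 3 and 4 have
      cancelled, this is what remains of the claim.\<close>
    have "(\<Sum>j\<in>{5..n}. ?s j) + 4 * ?s n / real n \<le> m * (real n - 2)"
      using n4 m level assms(4) by (intro water_level_bound) auto
    moreover have "(\<Sum>j\<in>{3..n}. ?s j) = ?s 3 + ?s 4 + (\<Sum>j\<in>{5..n}. ?s j)"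
      using n4 by (simp add: sum.atLeast_Suc_atMost eval_nat_numeral)
    ultimately show ?thesis
      using three n4 by (intro order_trans[OF risk] ennreal_leI) simp
  qed
  have "4 * ?s n / real n \<ge> 0"
    using s_pos[OF m(2)] by simp
  then show ?thesis
    using case3 case4 unfolding n_def by auto
qed

end
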